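(* Let $\|\cdot\|$ be a smooth and strictly convex norm on $\mathbb{R}^n$, let $K\subseteq\mathbb{R}^n$ be a convex body, and let $d_K(x)=\inf\{\|x-y\|:y\in K\}$. Then the norm gradient $\nabla d_K$ of the distance function $d_K$ is continuous in $\mathbb{R}^n\setminus K$. In particular, $d_K$ is a function of class $C^1$ in $\mathbb{R}^n\setminus K$.
   Context: A convex body is a compact convex set with non-empty interior. A hyperplane $\mathbf{h}$ supports a closed convex set $C$ at $x\in\partial C$ if $C$ is contained in one of the closed half-spaces determined by the translate of $\mathbf{h}$ through $x$. A norm is smooth if its unit ball $B=\{x:\|x\|\le 1\}$ has a unique supporting hyperplane at each boundary point, and strictly convex if $\partial B$ contains no (non-degenerate) line segment. Birkhoff orthogonality: $x\dashv_B y$ means $\|x+ty\|\ge\|x\|$ for all $t\in\mathbb{R}$; for a hyperplane $\mathbf{h}$ (taken through the origin), $x\dashv_B\mathbf{h}$ ($x$ is Birkhoff left-orthogonal to $\mathbf{h}$) means $x\dashv_B z$ for all $z\in\mathbf{h}$. Norm gradient: let $f:\mathbb{R}^n\to\mathbb{R}$ be convex and (Fréchet) differentiable at $x$, and put $c=f(x)$. If $c$ is not the global minimum of $f$, then $\nabla f(x)$ is the unique non-zero vector such that (a) $\nabla f(x)$ is Birkhoff left-orthogonal to the (unique) supporting hyperplane of the sub-level set $\{f\le c\}$ at $x$, and (b) $df_x(\nabla f(x))=\|\nabla f(x)\|^2$. If $c$ is the global minimum, $\nabla f(x)=0$. The function $d_K$ is convex, and it is differentiable at every point of $\mathbb{R}^n\setminus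 K$, so $\nabla d_K$ is defined there. A differentiable function is of class $C^1$ on an open set if its usual (Euclidean) gradient is continuous there. *)

theory Defs
  imports "HOL-Analysis.Analysis"
begin

text \<open>
  An arbitrary norm \<open>N\<close> is considered on \<open>real ^ 'n\<close>. The topology, differentiability and
  the inner product are those of the type; since the dimension is finite, topology and
  Frechet differentiability do not depend on the norm used.
\<close>

definition is_norm :: "(real ^ 'n \<Rightarrow> real) \<Rightarrow> bool" where
  "is_norm N \<longleftrightarrow>
     (\<forall>x. 0 \<le> N x) \<and>
     (\<forall>x. N x = 0 \<longleftrightarrow> x = 0) \<and>
     (\<forall>c x. N (c *\<^sub>R x) = \<bar>c\<bar> * N x) \<and>
     (\<forall>x y. N (x + y) \<le> N x + N y)"

definition unit_ball :: "(real ^ 'n \<Rightarrow> real) \<Rightarrow> (real ^ 'n) set" where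
  "unit_ball N = {x. N x \<le> 1}"

definition convex_body :: "(real ^ 'n) set \<Rightarrow> bool" where
  "convex_body K \<longleftrightarrow> compact K \<and> convex K \<and> interior K \<noteq> {}"

text \<open>
  A hyperplane is represented by its translate \<open>H\<close> through the origin, so uniqueness of a
  supporting hyperplane means uniqueness of this set \<open>H\<close>, not of a normal vector.
\<close>

definition supports_at :: "(real ^ 'n) set \<Rightarrow> (real ^ 'n) set \<Rightarrow> real ^ 'n \<Rightarrow> bool" where
  "supports_at H C x \<longleftrightarrow>
     closed C \<and> convex C \<and> x \<in> frontier C \<and>
     (\<exists>a. a \<noteq> 0 \<and> H = {z. a \<bullet> z = 0} \<and>
          (C \<subseteq> {y. a \<bullet> y \<le> a \<bullet> x} \<or> C \<subseteq> {y. a \<bullet> y \<ge> a \<bullet> x}))"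

definition smooth_norm :: "(real ^ 'n \<Rightarrow> real) \<Rightarrow> bool" where
  "smooth_norm N \<longleftrightarrow>
     (\<forall>x \<in> frontier (unit_ball N). \<exists>!H. supports_at H (unit_ball N) x)"

definition strictly_convex_norm :: "(real ^ 'n \<Rightarrow> real) \<Rightarrow> bool" where
  "strictly_convex_norm N \<longleftrightarrow>
     (\<nexists>a b. a \<noteq> b \<and> closed_segment a b \<subseteq> frontier (unit_ball N))"

definition birkhoff_orthogonal :: "(real ^ 'n \<Rightarrow> real) \<Rightarrow> real ^ 'n \<Rightarrow> real ^ 'n \<Rightarrow> bool" where
  "birkhoff_orthogonal N x y \<longleftrightarrow> (\<forall>t. N (x + t *\<^sub>R y) \<ge> N x)"

definition birkhoff_left_orthogonal ::
    "(real ^ 'n \<Rightarrow> real) \<Rightarrow> real ^ 'n \<Rightarrow> (real ^ 'n) set \<Rightarrow> bool" where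
  "birkhoff_left_orthogonal N x H \<longleftrightarrow> (\<forall>z \<in> H. birkhoff_orthogonal N x z)"

text \<open>
  The next two definitions are meant for \<open>f\<close> convex and differentiable at \<open>x\<close>; the first one
  covers the case where \<open>f x\<close> is not the global minimum of \<open>f\<close>.
\<close>

definition is_norm_gradient ::
    "(real ^ 'n \<Rightarrow> real) \<Rightarrow> (real ^ 'n \<Rightarrow> real) \<Rightarrow> real ^ 'n \<Rightarrow> real ^ 'n \<Rightarrow> bool" where
  "is_norm_gradient N f x v \<longleftrightarrow>
     v \<noteq> 0 \<and>
     (\<exists>!H. supports_at H {y. f y \<le> f x} x) \<and>
     (\<forall>H. supports_at H {y. f y \<le> f x} x \<longrightarrow> birkhoff_left_orthogonal N v H) \<and>
     frechet_derivative f (at x) v = (N v)\<^sup>2"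

definition norm_gradient ::
    "(real ^ 'n \<Rightarrow> real) \<Rightarrow> (real ^ 'n \<Rightarrow> real) \<Rightarrow> real ^ 'n \<Rightarrow> real ^ 'n" where
  "norm_gradient N f x =
     (if \<forall>y. f x \<le> f y then 0 else (THE v. is_norm_gradient N f x v))"

definition norm_dist :: "(real ^ 'n \<Rightarrow> real) \<Rightarrow> (real ^ 'n) set \<Rightarrow> real ^ 'n \<Rightarrow> real" where
  "norm_dist N K x = (INF y\<in>K. N (x - y))"

text \<open>Here \<open>g\<close> is the usual (Euclidean) gradient; \<open>S\<close> is meant to be open.\<close>

definition class_C1_on :: "(real ^ 'n \<Rightarrow> real) \<Rightarrow> (real ^ 'n) set \<Rightarrow> bool" where
  "class_C1_on f S \<longleftrightarrow> (\<exists>g. (\<forall>x \<in> S. GDERIV f x :> g x) \<and> continuous_on S g)"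

end

theory Submission
  imports Defs
begin

text \<open>
  For \<open>x \<notin> K\<close> let \<open>p\<close> be a nearest point of \<open>K\<close> and \<open>u\<close> the unit vector in
  direction \<open>x - p\<close>. Separating \<open>K\<close> from the open ball of radius \<open>d x\<close> about
  \<open>x\<close> gives a functional \<open>a\<close> of dual norm at most 1 with \<open>d y \<ge> d x + a \<bullet> (y - x)\<close> for all
  \<open>y\<close>, and then \<open>a \<bullet> u = 1\<close>. Strict convexity makes \<open>p\<close> unique, smoothness makes
  \<open>a\<close> unique, so both depend continuously on \<open>x\<close> by the closed graph theorem for maps into
  compact sets. The subgradient inequalities at \<open>x\<close> and at \<open>y\<close> squeeze
  \<open>d y - d x - a x \<bullet> (y - x)\<close> between \<open>0\<close> and \<open>(a y - a x) \<bullet> (y - x)\<close>, so \<open>a\<close> is the Euclidean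
  gradient of \<open>d\<close>, while \<open>u\<close> is its norm gradient.
\<close>

section \<open>Closed graphs, sublevel sets and kernels of functionals\<close>

lemma continuous_on_closed_graph_unique:
  fixes f :: "'a::euclidean_space \<Rightarrow> 'b::euclidean_space"
  assumes "compact T" and clo: "closedin (top_of_set (S \<times> T)) G"
    and f: "\<And>x. x \<in> S \<Longrightarrow> (x, f x) \<in> G"
    and uniq: "\<And>x y. (x, y) \<in> G \<Longrightarrow> y = f x"
  shows "continuous_on S f"
proof -
  have sub: "G \<subseteq> S \<times> T"
    using clo closedin_subset by fastforce
  \<comment> \<open>Uniqueness makes the closed relation \<open>G\<close> the whole graph of
    \<open>f\<close>; a closed graph over a compact target gives continuity.\<close>
  have "(\<lambda>x. (x, f x)) ` S = G"
    using sub f uniq by fastforce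
  moreover have "f \<in> S \<rightarrow> T"
    using sub f by fastforce
  ultimately show ?thesis
    using clo \<open>compact T\<close> by (simp add: continuous_closed_graph_eq)
qed

lemma convex_sublevel:
  assumes "convex_on UNIV (f :: 'a::real_vector \<Rightarrow> real)"
  shows "convex {x. f x \<le> c}" and "convex {x. f x < c}"
proof -
  have le: "f (u *\<^sub>R x + v *\<^sub>R y) \<le> u * f x + v * f y"
    if "0 \<le> u" "0 \<le> v" "u + v = 1" for u v x y
    using assms that by (simp add: convex_on_def)
  show "convex {x. f x \<le> c}" and "convex {x. f x < c}"
    unfolding convex_def mem_Collect_eq
    by (blast intro: order_trans le_less_trans le convex_bound_le convex_bound_lt)+
qed

text \<open>Functionals with the same kernel are proportional, and the common value at
  \<open>u\<close> fixes the factor. This turns uniqueness of a hyperplane, which is a set without a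
  normal, into uniqueness of a vector.\<close>

lemma inner_eq_if_same_kernel:
  fixes a b u :: "'a::real_inner"
  assumes "{z. a \<bullet> z = 0} = {z. b \<bullet> z = 0}" and "a \<bullet> u = 1" and "b \<bullet> u = 1"
  shows "a = b"
proof -
  have "a \<bullet> y = b \<bullet> y" for y
  proof -
    have "y - (a \<bullet> y) *\<^sub>R u \<in> {z. a \<bullet> z = 0}"
      by (simp add: inner_diff_right assms(2))
    then have "b \<bullet> (y - (a \<bullet> y) *\<^sub>R u) = 0"
      using assms(1) by blast
    then show ?thesis
      by (simp add: inner_diff_right assms(3))
  qed
  then show ?thesis
    by (metis vector_eq_rdot)
qed

section \<open>Norms, the dual unit ball, and uniqueness of norming functionals and vectors\<close>

definition dual_ball :: "(real ^ 'n \<Rightarrow> real) \<Rightarrow> (real ^ 'n) set" where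
  "dual_ball N = {a. \<forall>y. a \<bullet> y \<le> N y}"

locale norm_function =
  fixes N :: "real ^ 'n \<Rightarrow> real"
  assumes is_norm: "is_norm N"
begin

lemma nonneg: "0 \<le> N x"
  and eq_0_iff: "N x = 0 \<longleftrightarrow> x = 0"
  and scale: "N (c *\<^sub>R x) = \<bar>c\<bar> * N x"
  and triangle: "N (x + y) \<le> N x + N y"
  using is_norm unfolding is_norm_def by auto

lemma zero: "N 0 = 0"
  by (simp add: eq_0_iff)

lemma minus: "N (- x) = N x"
  using scale[of "-1" x] by simp

lemma pos: "x \<noteq> 0 \<Longrightarrow> 0 < N x"
  using nonneg eq_0_iff by (simp add: less_le)

lemma convex_on: "convex_on UNIV N"
proof (rule convex_onI)
  fix t x y assume "0 < (t::real)" "t < 1"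
  then show "N ((1 - t) *\<^sub>R x + t *\<^sub>R y) \<le> (1 - t) * N x + t * N y"
    using triangle[of "(1 - t) *\<^sub>R x" "t *\<^sub>R y"] by (simp add: scale)
qed simp

lemma continuous_on [continuous_intros]:
  "continuous_on S f \<Longrightarrow> continuous_on S (\<lambda>x. N (f x))"
  using continuous_on_compose2[OF convex_on_continuous[OF open_UNIV convex_on]] by blast

lemma bounded_by_norm: "\<exists>C>0. \<forall>x. N x \<le> C * norm x"
proof -
  let ?S = "sphere (0 :: real ^ 'n) 1"
  have S: "compact ?S" "?S \<noteq> {}" "continuous_on ?S N"
    using continuous_on[OF continuous_on_id] by auto
  obtain w where w: "w \<in> ?S" "\<And>y. y \<in> ?S \<Longrightarrow> N y \<le> N w"
    using continuous_attains_sup[OF S] by blast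
  have "N x \<le> N w * norm x" for x
  proof (cases "x = 0")
    case False
    have "N x = N (x /\<^sub>R norm x) * norm x"
      using False by (simp add: scale)
    also have "\<dots> \<le> N w * norm x"
      using False by (intro mult_right_mono w(2)) auto
    finally show ?thesis .
  qed (simp add: zero)
  moreover have "0 < N w"
    using w(1) by (auto intro!: pos)
  ultimately show ?thesis
    by blast
qed

lemma compact_dual_ball: "compact (dual_ball N)"
proof -
  obtain C where C: "0 < C" "\<And>x. N x \<le> C * norm x"
    using bounded_by_norm by auto
  have "norm a \<le> C" if "a \<in> dual_ball N" for a
  proof -
    \<comment> \<open>Testing the functional \<open>a\<close> on the vector \<open>a\<close> itself
      bounds its Euclidean length.\<close>
    have "norm a * norm a = a \<bullet> a"
      by (metis power2_eq_square power2_norm_eq_inner)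
    also have "\<dots> \<le> N a"
      using that by (simp add: dual_ball_def)
    also have "\<dots> \<le> C * norm a"
      by (rule C)
    finally show ?thesis
      using C(1) by (cases "a = 0") auto
  qed
  then have "bounded (dual_ball N)"
    by (meson bounded_iff)
  moreover have "closed (dual_ball N)"
    unfolding dual_ball_def
    by (intro closed_Collect_all closed_Collect_le continuous_intros)
  ultimately show ?thesis
    by (simp add: compact_eq_bounded_closed)
qed

lemma closed_unit_ball: "closed (unit_ball N)"
  unfolding unit_ball_def by (intro closed_Collect_le continuous_intros)

lemma convex_unit_ball: "convex (unit_ball N)"
  unfolding unit_ball_def by (rule convex_sublevel(1)[OF convex_on])

lemma unit_in_frontier:
  assumes "N u = 1"
  shows "u \<in> frontier (unit_ball N)"
proof -
  have "u \<notin> interior (unit_ball N)"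
  proof
    assume "u \<in> interior (unit_ball N)"
    then obtain e where e: "e > 0" "cball u e \<subseteq> unit_ball N"
      by (auto simp: mem_interior_cball)
    have "u \<noteq> 0"
      using assms zero by auto
    \<comment> \<open>Stretching \<open>u\<close> by Euclidean length \<open>e\<close> stays in the
      ball around \<open>u\<close> but pushes \<open>N\<close> above 1.\<close>
    then have "(1 + e / norm u) *\<^sub>R u \<in> cball u e"
      using e by (simp add: dist_norm algebra_simps)
    then have "N ((1 + e / norm u) *\<^sub>R u) \<le> 1"
      using e by (auto simp: unit_ball_def)
    moreover have "0 < e / norm u"
      using e(1) \<open>u \<noteq> 0\<close> by simp
    ultimately show False
      using assms by (simp add: scale)
  qed
  then show ?thesis
    using assms by (simp add: frontier_def closed_unit_ball closure_closed) (simp add: unit_ball_def)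
qed

lemma dual_supports_unit_ball:
  assumes "N u = 1" "a \<in> dual_ball N" "a \<bullet> u = 1"
  shows "supports_at {z. a \<bullet> z = 0} (unit_ball N) u"
proof -
  have "unit_ball N \<subseteq> {y. a \<bullet> y \<le> a \<bullet> u}"
    using assms order_trans by (fastforce simp: unit_ball_def dual_ball_def)
  moreover have "a \<noteq> 0"
    using assms by auto
  ultimately show ?thesis
    using closed_unit_ball convex_unit_ball unit_in_frontier[OF assms(1)]
    unfolding supports_at_def by blast
qed

text \<open>Both kernels support the unit ball at \<open>u\<close>, so smoothness makes them equal,
  and the value 1 at \<open>u\<close> removes the remaining scalar.\<close>

lemma dual_unique:
  assumes "smooth_norm N" "N u = 1"
    and "a \<in> dual_ball N" "a \<bullet> u = 1" "b \<in> dual_ball N" "b \<bullet> u = 1"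
  shows "a = b"
proof (rule inner_eq_if_same_kernel)
  show "{z. a \<bullet> z = 0} = {z. b \<bullet> z = 0}"
    using assms dual_supports_unit_ball unit_in_frontier unfolding smooth_norm_def by metis
qed (use assms in auto)

text \<open>The part of the unit ball on which \<open>a\<close> equals 1 is convex and consists of
  vectors of norm 1, so two distinct points in it would span a segment in the boundary.\<close>

lemma unit_unique:
  assumes "strictly_convex_norm N" "a \<in> dual_ball N"
    and "N u = 1" "a \<bullet> u = 1" "N v = 1" "a \<bullet> v = 1"
  shows "u = v"
proof (rule ccontr)
  assume "u \<noteq> v"
  have "w \<in> frontier (unit_ball N)" if "w \<in> closed_segment u v" for w
  proof -
    have "closed_segment u v \<subseteq> unit_ball N \<inter> {y. a \<bullet> y = 1}"
      using assms(3-6)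
      by (intro closed_segment_subset convex_Int convex_unit_ball convex_hyperplane)
        (simp_all add: unit_ball_def)
    then have "N w \<le> 1" "a \<bullet> w = 1"
      using that by (auto simp: unit_ball_def)
    moreover have "a \<bullet> w \<le> N w"
      using assms(2) by (simp add: dual_ball_def)
    ultimately have "N w = 1"
      by simp
    then show ?thesis
      by (rule unit_in_frontier)
  qed
  then show False
    using assms(1) \<open>u \<noteq> v\<close> unfolding strictly_convex_norm_def by blast
qed

end

section \<open>The distance to a convex body\<close>

locale norm_convex_body = norm_function N for N :: "real ^ 'n \<Rightarrow> real" +
  fixes K :: "(real ^ 'n) set"
  assumes convex_body: "convex_body K"
begin

abbreviation "d \<equiv> norm_dist N K"

lemma compact: "compact K" and convex: "convex K" and nonempty: "K \<noteq> {}"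
  using convex_body by (auto simp: convex_body_def)

lemma dist_le: "k \<in> K \<Longrightarrow> d x \<le> N (x - k)"
  unfolding norm_dist_def by (rule cINF_lower) (auto intro: bdd_belowI2 nonneg)

lemma dist_greatest: "(\<And>k. k \<in> K \<Longrightarrow> m \<le> N (x - k)) \<Longrightarrow> m \<le> d x"
  unfolding norm_dist_def by (intro cINF_greatest nonempty)

lemma dist_attained:
  obtains p where "p \<in> K" "d x = N (x - p)"
proof -
  have "\<exists>p\<in>K. \<forall>y\<in>K. N (x - p) \<le> N (x - y)"
    by (intro continuous_attains_inf compact nonempty continuous_intros)
  then show ?thesis
    using that dist_le dist_greatest by (meson antisym)
qed

text \<open>An arbitrary choice at this stage: without strict convexity there may be several nearest
  points.\<close>

definition proj :: "real ^ 'n \<Rightarrow> real ^ 'n" where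
  "proj x = (SOME p. p \<in> K \<and> d x = N (x - p))"

lemma proj: "proj x \<in> K" "d x = N (x - proj x)"
proof -
  have "\<exists>p. p \<in> K \<and> d x = N (x - p)"
    using dist_attained by blast
  from someI_ex[OF this, folded proj_def] show "proj x \<in> K" "d x = N (x - proj x)"
    by blast+
qed

lemma dist_pos: "x \<notin> K \<Longrightarrow> 0 < d x"
  using proj[of x] by (metis pos right_minus_eq)

lemma dist_eq_0: "x \<in> K \<Longrightarrow> d x = 0"
  using dist_le[of x x] proj(2)[of x] nonneg[of "x - proj x"] by (simp add: zero)

lemma convex_on_dist: "convex_on UNIV d"
proof (rule convex_onI)
  fix t x y assume t: "0 < (t::real)" "t < 1"
  let ?k = "(1 - t) *\<^sub>R proj x + t *\<^sub>R proj y"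
  have "?k \<in> K"
    using convex t proj(1) by (simp add: convex_alt)
  then have "d ((1 - t) *\<^sub>R x + t *\<^sub>R y) \<le> N ((1 - t) *\<^sub>R x + t *\<^sub>R y - ?k)"
    by (rule dist_le)
  also have "\<dots> = N ((1 - t) *\<^sub>R (x - proj x) + t *\<^sub>R (y - proj y))"
    by (simp add: algebra_simps)
  also have "\<dots> \<le> (1 - t) * N (x - proj x) + t * N (y - proj y)"
    using t by (intro convex_onD[OF convex_on]) auto
  finally show "d ((1 - t) *\<^sub>R x + t *\<^sub>R y) \<le> (1 - t) * d x + t * d y"
    by (simp flip: proj(2))
qed simp

lemma continuous_on_dist [continuous_intros]:
  "continuous_on S f \<Longrightarrow> continuous_on S (\<lambda>x. d (f x))"
  using continuous_on_compose2[OF convex_on_continuous[OF open_UNIV convex_on_dist]] by blast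

section \<open>Separation and subgradients\<close>

lemma subgradient_exists:
  assumes "x \<notin> K"
  obtains a where "a \<in> dual_ball N" "\<And>k. k \<in> K \<Longrightarrow> d x \<le> a \<bullet> (x - k)"
proof -
  let ?T = "{z. N (z - x) < d x}"
  have dpos: "0 < d x"
    by (rule dist_pos[OF assms])
  have "convex ?T"
  proof -
    have "convex ((\<lambda>y. x + y) ` {y. N y < d x})"
      by (intro convex_translation convex_sublevel(2) convex_on)
    also have "(\<lambda>y. x + y) ` {y. N y < d x} = ?T"
    proof (intro equalityI subsetI)
      fix z assume "z \<in> ?T"
      then show "z \<in> (\<lambda>y. x + y) ` {y. N y < d x}"
        by (intro image_eqI[of _ _ "z - x"]) auto
    qed auto
    finally show ?thesis .
  qed
  moreover have "x \<in> ?T"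
    using dpos by (simp add: zero)
  moreover have "K \<inter> ?T = {}"
  proof -
    have "\<not> N (k - x) < d x" if "k \<in> K" for k
      using dist_le[OF that, of x] minus[of "k - x"] by simp
    then show ?thesis
      by blast
  qed
  ultimately obtain a b where a: "a \<noteq> 0" "\<And>k. k \<in> K \<Longrightarrow> a \<bullet> k \<le> b"
      "\<And>z. N (z - x) < d x \<Longrightarrow> b \<le> a \<bullet> z"
    using separating_hyperplane_sets[OF convex, of ?T] nonempty by blast
  \<comment> \<open>The separating functional exceeds \<open>b\<close> by \<open>r\<close> at the
    centre \<open>x\<close>, so it is at most \<open>r\<close> on the open ball of radius
    \<open>d x\<close> about the origin. Its dual norm is thus at most \<open>r / d x\<close>, and
    scaling by \<open>d x / r\<close> puts it in the dual ball.\<close>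
  define r where "r = a \<bullet> x - b"
  have ball: "a \<bullet> y \<le> r" if "N y < d x" for y
    using a(3)[of "x - y"] that minus[of y] by (simp add: r_def inner_diff_right)
  have bound: "d x * (a \<bullet> y) \<le> r * N y" for y
  proof (cases "y = 0")
    case False
    then have Ny: "0 < N y"
      by (rule pos)
    \<comment> \<open>The separated ball is open, so \<open>y\<close> is scaled to norm
      \<open>s * d x\<close> with \<open>s < 1\<close>, and \<open>s\<close> then tends to
      1.\<close>
    have "s * ((d x / N y) * (a \<bullet> y)) \<le> r" if "0 < s" "s < 1" for s
      using ball[of "(s * (d x / N y)) *\<^sub>R y"] that Ny dpos by (simp add: scale)
    then have "(d x / N y) * (a \<bullet> y) \<le> r"
      by (rule field_le_mult_one_interval)
    then show ?thesis
      using Ny by (simp add: field_simps)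
  qed (simp add: zero)
  have r: "0 < r"
  proof -
    have "0 < d x * (a \<bullet> a)"
      using dpos a(1) by simp
    also have "\<dots> \<le> r * N a"
      by (rule bound)
    finally show ?thesis
      using nonneg[of a] by (simp add: zero_less_mult_iff)
  qed
  show ?thesis
  proof
    show "(d x / r) *\<^sub>R a \<in> dual_ball N"
      using bound r by (simp add: dual_ball_def field_simps)
    show "d x \<le> ((d x / r) *\<^sub>R a) \<bullet> (x - k)" if "k \<in> K" for k
    proof -
      have "d x * r \<le> d x * (a \<bullet> (x - k))"
        using a(2)[OF that] dpos by (simp add: r_def inner_diff_right)
      then show ?thesis
        using r by (simp add: field_simps)
    qed
  qed
qed

definition dir :: "real ^ 'n \<Rightarrow> real ^ 'n" where
  "dir x = (x - proj x) /\<^sub>R d x"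

text \<open>Only a separating functional is chosen here. Smoothness later makes it unique, and it
  proves to be the Euclidean gradient of \<open>d\<close>.\<close>

definition grad :: "real ^ 'n \<Rightarrow> real ^ 'n" where
  "grad x = (SOME a. a \<in> dual_ball N \<and> (\<forall>k\<in>K. d x \<le> a \<bullet> (x - k)))"

lemma grad:
  assumes "x \<notin> K"
  shows "grad x \<in> dual_ball N" and "k \<in> K \<Longrightarrow> d x \<le> grad x \<bullet> (x - k)"
proof -
  have "\<exists>a. a \<in> dual_ball N \<and> (\<forall>k\<in>K. d x \<le> a \<bullet> (x - k))"
    by (rule subgradient_exists[OF assms]) blast
  from someI_ex[OF this, folded grad_def]
  show "grad x \<in> dual_ball N" and "k \<in> K \<Longrightarrow> d x \<le> grad x \<bullet> (x - k)"
    by blast+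
qed

lemma grad_le: "x \<notin> K \<Longrightarrow> grad x \<bullet> y \<le> N y"
  using grad(1) by (simp add: dual_ball_def)

lemma grad_nearest:
  assumes "x \<notin> K" "p \<in> K" "d x = N (x - p)"
  shows "grad x \<bullet> (x - p) = d x"
  using grad(2)[OF assms(1,2)] grad_le[OF assms(1), of "x - p"] assms(3) by simp

lemma grad_dir: "x \<notin> K \<Longrightarrow> grad x \<bullet> dir x = 1"
  using grad_nearest[OF _ proj] dist_pos[of x] by (simp add: dir_def)

lemma N_dir: "x \<notin> K \<Longrightarrow> N (dir x) = 1"
  using dist_pos[of x] by (simp add: dir_def scale flip: proj(2))

text \<open>Each \<open>N (y - k)\<close> is at least \<open>grad x \<bullet> (y - k)\<close>;
  splitting \<open>y - k\<close> at \<open>x\<close> leaves a term that separation bounds below by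
  \<open>d x\<close>.\<close>

lemma subgradient:
  assumes "x \<notin> K"
  shows "d x + grad x \<bullet> (y - x) \<le> d y"
proof (rule dist_greatest)
  fix k assume "k \<in> K"
  then have "d x + grad x \<bullet> (y - x) \<le> grad x \<bullet> (x - k) + grad x \<bullet> (y - x)"
    using grad(2)[OF assms] by simp
  also have "\<dots> = grad x \<bullet> (y - k)"
    by (simp add: inner_diff_right)
  also have "\<dots> \<le> N (y - k)"
    by (rule grad_le[OF assms])
  finally show "d x + grad x \<bullet> (y - x) \<le> N (y - k)" .
qed

section \<open>Supporting hyperplanes of the sublevel sets\<close>

lemma level_in_frontier:
  assumes "x \<notin> K"
  shows "x \<in> frontier {y. d y \<le> d x}"
proof -
  have "x \<notin> interior {y. d y \<le> d x}"
  proof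
    assume "x \<in> interior {y. d y \<le> d x}"
    then obtain e where e: "e > 0" "cball x e \<subseteq> {y. d y \<le> d x}"
      by (auto simp: mem_interior_cball)
    let ?g = "grad x"
    have g: "?g \<noteq> 0"
      using grad_dir[OF assms] by auto
    then have "x + (e / norm ?g) *\<^sub>R ?g \<in> cball x e"
      using e by (simp add: dist_norm)
    then have "d (x + (e / norm ?g) *\<^sub>R ?g) \<le> d x"
      using e by blast
    moreover have "0 < ?g \<bullet> ((e / norm ?g) *\<^sub>R ?g)"
      using e g by simp
    ultimately show False
      using subgradient[OF assms, of "x + (e / norm ?g) *\<^sub>R ?g"] by simp
  qed
  then show ?thesis
    by (auto simp: frontier_def intro: subsetD[OF closure_subset])
qed

text \<open>The sublevel set contains the \<open>N\<close>-ball of radius \<open>d x\<close> about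
  \<open>proj x\<close>, which has \<open>x\<close> on its boundary. A hyperplane supporting the
  sublevel set at \<open>x\<close> therefore supports this ball there, and smoothness leaves only
  the kernel of \<open>grad x\<close>.\<close>

lemma supports_level_iff:
  assumes "smooth_norm N" "x \<notin> K"
  shows "supports_at H {y. d y \<le> d x} x \<longleftrightarrow> H = {z. grad x \<bullet> z = 0}"
proof
  have "{y. d y \<le> d x} \<subseteq> {y. grad x \<bullet> y \<le> grad x \<bullet> x}"
    using subgradient[OF assms(2)] by (smt (verit) Collect_mono inner_diff_right)
  moreover have "closed {y. d y \<le> d x}"
    by (intro closed_Collect_le continuous_intros)
  moreover have "convex {y. d y \<le> d x}"
    by (rule convex_sublevel(1)[OF convex_on_dist])
  moreover have "grad x \<noteq> 0"
    using grad_dir[OF assms(2)] by auto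
  moreover assume "H = {z. grad x \<bullet> z = 0}"
  ultimately show "supports_at H {y. d y \<le> d x} x"
    using level_in_frontier[OF assms(2)] unfolding supports_at_def by blast
next
  assume "supports_at H {y. d y \<le> d x} x"
  then obtain b' where b': "b' \<noteq> 0" "H = {z. b' \<bullet> z = 0}"
      "{y. d y \<le> d x} \<subseteq> {y. b' \<bullet> y \<le> b' \<bullet> x} \<or> {y. d y \<le> d x} \<subseteq> {y. b' \<bullet> y \<ge> b' \<bullet> x}"
    unfolding supports_at_def by blast
  \<comment> \<open>Negating the normal keeps \<open>H\<close> and swaps the two half-spaces, so one
    side suffices.\<close>
  have "\<exists>b. b \<noteq> 0 \<and> H = {z. b \<bullet> z = 0} \<and> {y. d y \<le> d x} \<subseteq> {y. b \<bullet> y \<le> b \<bullet> x}"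
    using b'(3)
  proof
    assume "{y. d y \<le> d x} \<subseteq> {y. b' \<bullet> y \<ge> b' \<bullet> x}"
    then show ?thesis
      using b'(1,2) by (intro exI[of _ "- b'"]) auto
  qed (use b' in blast)
  then obtain b where b: "b \<noteq> 0" "H = {z. b \<bullet> z = 0}" "\<And>y. d y \<le> d x \<Longrightarrow> b \<bullet> y \<le> b \<bullet> x"
    by blast
  have dpos: "0 < d x"
    by (rule dist_pos[OF assms(2)])
  have x: "x = proj x + d x *\<^sub>R dir x"
    using dpos by (simp add: dir_def)
  \<comment> \<open>Scaling \<open>w\<close> onto the boundary of the ball about
    \<open>proj x\<close> compares it with \<open>x\<close>. Once \<open>b \<bullet> dir x\<close>
    is known to be positive, the estimate says that \<open>b\<close> divided by it lies in the dual
    ball.\<close>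
  have le: "b \<bullet> w \<le> (b \<bullet> dir x) * N w" for w
  proof (cases "w = 0")
    case False
    then have Nw: "0 < N w"
      by (rule pos)
    let ?y = "proj x + (d x / N w) *\<^sub>R w"
    have "d ?y \<le> N (?y - proj x)"
      by (intro dist_le proj)
    also have "\<dots> = d x"
      using Nw dpos by (simp add: scale)
    finally have "b \<bullet> ?y \<le> b \<bullet> x"
      by (rule b(3))
    also have "\<dots> = b \<bullet> (proj x + d x *\<^sub>R dir x)"
      using x by simp
    finally have "(d x / N w) * (b \<bullet> w) \<le> d x * (b \<bullet> dir x)"
      by (simp add: inner_add_right)
    then show ?thesis
      using Nw dpos by (simp add: field_simps)
  qed (simp add: zero)
  have c: "0 < b \<bullet> dir x"
    using le[of b] b(1) nonneg[of b]
    by (metis inner_gt_zero_iff less_le_trans less_le_not_le zero_less_mult_iff)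
  have "grad x = b /\<^sub>R (b \<bullet> dir x)"
  proof (rule dual_unique[OF assms(1) N_dir[OF assms(2)]])
    show "b /\<^sub>R (b \<bullet> dir x) \<in> dual_ball N"
      using le c by (simp add: dual_ball_def field_simps)
  qed (use c grad[OF assms(2)] grad_dir[OF assms(2)] in auto)
  then show "H = {z. grad x \<bullet> z = 0}"
    using c b(2) by simp
qed

end

section \<open>Continuity, derivative and norm gradient for smooth, strictly convex norms\<close>

locale smooth_strictly_convex_body = norm_convex_body +
  assumes smooth: "smooth_norm N"
    and strictly_convex: "strictly_convex_norm N"
begin

text \<open>Every nearest point gives a unit vector at which \<open>grad x\<close> takes the value
  1, and strict convexity allows only one such vector.\<close>

lemma nearest_unique:
  assumes "x \<notin> K" "p \<in> K" "d x = N (x - p)"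
  shows "p = proj x"
proof -
  have "(x - p) /\<^sub>R d x = dir x"
  proof (rule unit_unique[OF strictly_convex grad(1)[OF assms(1)]])
    show "N ((x - p) /\<^sub>R d x) = 1"
      using dist_pos[OF assms(1)] by (simp add: scale flip: assms(3))
    show "grad x \<bullet> ((x - p) /\<^sub>R d x) = 1"
      using dist_pos[OF assms(1)] by (simp add: grad_nearest[OF assms])
  qed (use assms N_dir grad_dir in auto)
  then show ?thesis
    using dist_pos[OF assms(1)] by (simp add: dir_def)
qed

lemma continuous_on_proj: "continuous_on (- K) proj"
proof (rule continuous_on_closed_graph_unique[OF compact])
  let ?G = "{z \<in> (- K) \<times> K. d (fst z) - N (fst z - snd z) = 0}"
  show "closedin (top_of_set ((- K) \<times> K)) ?G"
    by (intro continuous_closedin_preimage_constant continuous_intros)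
  show "(x, proj x) \<in> ?G" if "x \<in> - K" for x
    using that proj by simp
  show "p = proj x" if "(x, p) \<in> ?G" for x p
    using that nearest_unique by simp
qed

lemma continuous_on_dir: "continuous_on (- K) dir"
  unfolding dir_def
  by (intro continuous_intros continuous_on_proj) (auto dest: dist_pos)

text \<open>By smoothness \<open>grad x\<close> is the only element of the dual ball with value 1 at
  \<open>dir x\<close>. This condition is closed in the pair because \<open>dir\<close> is already
  continuous.\<close>

lemma continuous_on_grad: "continuous_on (- K) grad"
proof (rule continuous_on_closed_graph_unique[OF compact_dual_ball])
  let ?G = "{z \<in> (- K) \<times> dual_ball N. snd z \<bullet> dir (fst z) = 1}"
  show "closedin (top_of_set ((- K) \<times> dual_ball N)) ?G"
    by (intro continuous_closedin_preimage_constant continuous_intros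
          continuous_on_compose2[OF continuous_on_dir]) auto
  show "(x, grad x) \<in> ?G" if "x \<in> - K" for x
    using that grad(1) grad_dir by simp
  show "a = grad x" if "(x, a) \<in> ?G" for x a
    using that by (auto intro!: dual_unique[OF smooth, of "dir x"] N_dir grad grad_dir)
qed

lemma has_derivative_dist:
  assumes "x \<notin> K"
  shows "(d has_derivative (\<lambda>h. h \<bullet> grad x)) (at x)"
  unfolding has_derivative_at_alt
proof (intro conjI allI impI)
  show "bounded_linear (\<lambda>h. h \<bullet> grad x)"
    by (rule bounded_linear_inner_left)
  fix e :: real assume "0 < e"
  have "open (- K)"
    using compact by (simp add: compact_imp_closed open_Compl)
  then have "isCont grad x"
    using continuous_on_grad assms by (simp add: continuous_on_eq_continuous_at)
  then obtain r1 where r1: "0 < r1" "\<And>y. dist y x < r1 \<Longrightarrow> dist (grad y) (grad x) < e"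
    using \<open>0 < e\<close> unfolding continuous_at_eps_delta by blast
  \<comment> \<open>The radius \<open>r2\<close> keeps \<open>y\<close> off \<open>K\<close>, so
    that the subgradient inequality is available at \<open>y\<close> as well as at
    \<open>x\<close>.\<close>
  obtain r2 where r2: "0 < r2" "ball x r2 \<subseteq> - K"
    using \<open>open (- K)\<close> assms by (meson ComplI open_contains_ball)
  show "\<exists>r>0. \<forall>y. norm (y - x) < r \<longrightarrow>
      norm (d y - d x - (y - x) \<bullet> grad x) \<le> e * norm (y - x)"
  proof (intro exI[of _ "min r1 r2"] conjI allI impI)
    fix y assume y: "norm (y - x) < min r1 r2"
    then have "y \<notin> K"
      using r2(2) by (auto simp: dist_norm norm_minus_commute)
    have "0 \<le> d y - d x - (y - x) \<bullet> grad x"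
      using subgradient[OF assms, of y] by (simp add: inner_commute)
    moreover have "d y - d x - (y - x) \<bullet> grad x \<le> (grad y - grad x) \<bullet> (y - x)"
      using subgradient[OF \<open>y \<notin> K\<close>, of x] by (simp add: inner_commute algebra_simps)
    moreover have "(grad y - grad x) \<bullet> (y - x) \<le> norm (grad y - grad x) * norm (y - x)"
      by (rule norm_cauchy_schwarz)
    moreover have "\<dots> \<le> e * norm (y - x)"
      using r1(2)[of y] y by (intro mult_right_mono) (auto simp: dist_norm)
    ultimately show "norm (d y - d x - (y - x) \<bullet> grad x) \<le> e * norm (y - x)"
      by simp
  qed (use r1 r2 in auto)
qed

lemma is_norm_gradient_dist_iff:
  assumes "x \<notin> K"
  shows "is_norm_gradient N d x v \<longleftrightarrow> v = dir x"
proof -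
  have frechet: "frechet_derivative d (at x) v = grad x \<bullet> v" for v
    using frechet_derivative_at[OF has_derivative_dist[OF assms]] by (metis inner_commute)
  have "is_norm_gradient N d x v \<longleftrightarrow> v \<noteq> 0 \<and>
      (\<forall>z. grad x \<bullet> z = 0 \<longrightarrow> (\<forall>t. N v \<le> N (v + t *\<^sub>R z))) \<and> grad x \<bullet> v = (N v)\<^sup>2"
    by (simp add: is_norm_gradient_def supports_level_iff[OF smooth assms] frechet
        birkhoff_left_orthogonal_def birkhoff_orthogonal_def)
  also have "\<dots> \<longleftrightarrow> v = dir x"
  proof (intro iffI)
    assume "v = dir x"
    moreover have "N (dir x) \<le> N (dir x + t *\<^sub>R z)" if "grad x \<bullet> z = 0" for t z
      using grad_le[OF assms, of "dir x + t *\<^sub>R z"] that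
      by (simp add: inner_add_right N_dir grad_dir assms)
    ultimately show "v \<noteq> 0 \<and>
      (\<forall>z. grad x \<bullet> z = 0 \<longrightarrow> (\<forall>t. N v \<le> N (v + t *\<^sub>R z))) \<and> grad x \<bullet> v = (N v)\<^sup>2"
      using N_dir[OF assms] grad_dir[OF assms] zero by auto
  next
    assume v: "v \<noteq> 0 \<and>
      (\<forall>z. grad x \<bullet> z = 0 \<longrightarrow> (\<forall>t. N v \<le> N (v + t *\<^sub>R z))) \<and> grad x \<bullet> v = (N v)\<^sup>2"
    \<comment> \<open>Removing this kernel component from \<open>v\<close> leaves
      \<open>(grad x \<bullet> v) *\<^sub>R dir x\<close>, whose norm is
      \<open>(N v)\<^sup>2\<close>. Birkhoff orthogonality thus gives
      \<open>N v \<le> (N v)\<^sup>2\<close>, while the dual bound gives the reverse, so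
      \<open>N v = 1\<close>.\<close>
    let ?z = "v - (grad x \<bullet> v) *\<^sub>R dir x"
    have "grad x \<bullet> ?z = 0"
      by (simp add: inner_diff_right grad_dir[OF assms])
    then have "N v \<le> N (v + (-1) *\<^sub>R ?z)"
      using v by blast
    then have "N v \<le> (N v)\<^sup>2"
      using v by (simp add: scale N_dir[OF assms])
    moreover have "(N v)\<^sup>2 \<le> N v"
      using v grad_le[OF assms, of v] by simp
    ultimately have "N v = 1"
      using pos[of v] v by (simp add: power2_eq_square)
    then show "v = dir x"
      using v by (intro unit_unique[OF strictly_convex grad(1)[OF assms]])
        (auto simp: N_dir grad_dir assms)
  qed
  finally show ?thesis .
qed

lemma norm_gradient_dist:
  assumes "x \<notin> K"
  shows "norm_gradient N d x = dir x"
proof -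
  obtain k where "k \<in> K"
    using nonempty by blast
  \<comment> \<open>The distance vanishes on \<open>K\<close>, so \<open>d x\<close> is not the
    global minimum and the default value 0 does not apply.\<close>
  then have "\<not> (\<forall>y. d x \<le> d y)"
    using dist_pos[OF assms] dist_eq_0 by (metis not_less)
  then show ?thesis
    unfolding norm_gradient_def is_norm_gradient_dist_iff[OF assms]
    by (simp only: if_False the_eq_trivial)
qed

end

theorem corollary5p1:
  fixes N :: "real ^ 'n \<Rightarrow> real" and K :: "(real ^ 'n) set"
  assumes "is_norm N"
    and "smooth_norm N"
    and "strictly_convex_norm N"
    and "convex_body K"
  shows "continuous_on (- K) (norm_gradient N (norm_dist N K)) \<and>
         class_C1_on (norm_dist N K) (- K)"
proof -
  interpret smooth_strictly_convex_body N K
    by unfold_locales (fact assms)+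
  have "continuous_on (- K) (norm_gradient N d)"
    using continuous_on_dir norm_gradient_dist by (metis ComplD continuous_on_cong)
  moreover have "class_C1_on d (- K)"
    unfolding class_C1_on_def gderiv_def
    using has_derivative_dist continuous_on_grad by blast
  ultimately show ?thesis ..
qed

end
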